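(* Let $0<\alpha<1$, $\lambda\ge 0$, $a>0$ and $y_a\in\mathbb{R}$. Let $$D=[0,a]\times[y_ae^{-\lambda a}-\gamma,\;y_ae^{-\lambda a}+\gamma],\qquad \gamma=\frac{2a^{\alpha}\,\|f\|_{[0,a]}\,e^{\lambda a}}{\Gamma(1+\alpha)},$$ and assume that the function $f:D\to\mathbb{R}$ is continuous for all $t\in[0,a]$. Assume further that $f$ fulfills a Lipschitz condition with respect to the second variable, meaning that there exists $L>0$ such that, for all $t\in[0,a]$, $$|f(t,y(t))-f(t,z(t))|\le L|y(t)-z(t)|\quad\text{for } y,z\in\Omega_\gamma.$$ If the Lipschitz constant $L$ is such that $$L<\frac{\Gamma(\alpha+1)}{2a^{\alpha}e^{\lambda a}},$$ then the operator $\mathcal{A}$ maps $\Omega_\gamma$ into itself and it is a contraction: there is $q\in[0,1)$ such that $$\|\mathcal{A}y-\mathcal{A}z\|_{[0,a]}\le q\,\|y-z\|_{[0,a]}\quad\text{for } y,z\in\Omega_\gamma.$$ Hence the integral equation $$y(t)=y_a e^{-\lambda t}-\frac{e^{-\lambda t}}{\Gamma(\alpha)}\left(\int_0^a e^{\lambda s}(a-s)^{\alpha-1}f(s,y(s))\,ds-\int_0^t e^{\lambda s}(t-s)^{\alpha-1}f(s,y(s))\,ds\right),\quad t\in[0,a],$$ has a unique solution $y^*\in\Omega_\gamma$, which is the unique fixed point of $\mathcal{A}$.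
   Context: For $g\in C([0,a])$, $\|g\|_{[0,a]}=\max_{t\in[0,a]}|g(t)|$; for the function $f$ of two variables, $\|f\|_{[0,a]}$ denotes the maximum of $|f|$ over $D$, so that $\gamma$ is defined implicitly. The set $\Omega_\gamma$ is $$\Omega_\gamma=\{y\in C([0,a]) : \|y-y_a e^{-\lambda t}\|_{[0,a]}\le\gamma\},$$ and the operator $\mathcal{A}$ is defined on $\Omega_\gamma$ by $$(\mathcal{A}y)(t)=y_a e^{-\lambda t}-\frac{1}{\Gamma(\alpha)}\int_0^a e^{-\lambda(t-s)}(a-s)^{\alpha-1}f(s,y(s))\,ds+\frac{1}{\Gamma(\alpha)}\int_0^t e^{-\lambda(t-s)}(t-s)^{\alpha-1}f(s,y(s))\,ds,\quad t\in[0,a].$$ Here $\Gamma$ is the Gamma function. The integral equation is the integral form of the terminal value problem of finding $y$ on $[0,a]$ such that $$\frac{e^{-\lambda t}}{\Gamma(1-\alpha)}\int_0^t (t-s)^{-\alpha}\,\frac{d\left(e^{\lambda s}y(s)\right)}{ds}\,ds=f(t,y(t)),\qquad e^{\lambda a}y(a)=y_a,$$ where the left-hand side of the differential equation is the Caputo tempered fractional derivative of $y$ of order $\alpha$ with tempering parameter $\lambda$.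
   Formalization: The set D is taken as all (t,u) with t in [0,a] and |u − y_a e^{-λt}| ≤ γ, centred at y_a e^{-λt} instead of y_a e^{-λa}, since graphs of functions in Ω_γ leave the printed D when λ>0 and y_a≠0; continuity of f and ‖f‖ (hence γ) refer to this D. *)

theory Defs
  imports "HOL-Analysis.Analysis" "HOL-Library.FuncSet"
begin

text \<open>On a nonempty compact set and for continuous \<open>g\<close> this supremum is the maximum of \<open>\<bar>g\<bar>\<close>.\<close>

definition max_norm :: "'a set \<Rightarrow> ('a \<Rightarrow> real) \<Rightarrow> real" where
  "max_norm S g = (SUP x\<in>S. \<bar>g x\<bar>)"

text \<open>\<open>C([0,a])\<close>: functions are fixed to \<open>undefined\<close> outside \<open>[0,a]\<close>, so that equality in HOL
  is equality on \<open>[0,a]\<close>.\<close>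

definition cont_fun :: "real \<Rightarrow> (real \<Rightarrow> real) set" where
  "cont_fun a = {y \<in> extensional {0..a}. continuous_on {0..a} y}"

definition Omega :: "real \<Rightarrow> real \<Rightarrow> real \<Rightarrow> real \<Rightarrow> (real \<Rightarrow> real) set" where
  "Omega lam a ya \<gamma> =
    {y \<in> cont_fun a. max_norm {0..a} (\<lambda>t. y t - ya * exp (- lam * t)) \<le> \<gamma>}"

text \<open>The domain of \<open>f\<close>.  The second coordinate is centred at \<open>ya * exp (- lam * t)\<close>, like the
  functions in \<open>Omega\<close>, and not at the terminal value \<open>ya * exp (- lam * a)\<close>: the domain has to
  contain the graphs of the functions in \<open>Omega\<close> for \<open>f (t, y t)\<close> to be defined.  It is exactly
  the union of these graphs (\<open>domain_eq_graphs\<close>), and it is the rectangle centred at the terminal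
  value if and only if that rectangle contains all the graphs (\<open>domain_eq_rectangle_iff\<close>,
  \<open>domain_subset_rectangle_iff\<close>).\<close>

definition rhs_domain :: "real \<Rightarrow> real \<Rightarrow> real \<Rightarrow> real \<Rightarrow> (real \<times> real) set" where
  "rhs_domain lam a ya \<gamma> =
    (SIGMA t:{0..a}. {ya * exp (- lam * t) - \<gamma> .. ya * exp (- lam * t) + \<gamma>})"

definition op_A ::
  "real \<Rightarrow> real \<Rightarrow> real \<Rightarrow> real \<Rightarrow> (real \<times> real \<Rightarrow> real) \<Rightarrow> (real \<Rightarrow> real) \<Rightarrow> real \<Rightarrow> real" where
  "op_A \<alpha> lam a ya f y = (\<lambda>t\<in>{0..a}.
     ya * exp (- lam * t)
     - 1 / Gamma \<alpha> *
         integral {0..a} (\<lambda>s. exp (- lam * (t - s)) * (a - s) powr (\<alpha> - 1) * f (s, y s))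
     + 1 / Gamma \<alpha> *
         integral {0..t} (\<lambda>s. exp (- lam * (t - s)) * (t - s) powr (\<alpha> - 1) * f (s, y s)))"

definition solves_integral_equation ::
  "real \<Rightarrow> real \<Rightarrow> real \<Rightarrow> real \<Rightarrow> (real \<times> real \<Rightarrow> real) \<Rightarrow> (real \<Rightarrow> real) \<Rightarrow> bool" where
  "solves_integral_equation \<alpha> lam a ya f y \<longleftrightarrow> (\<forall>t\<in>{0..a}.
     y t = ya * exp (- lam * t) - exp (- lam * t) / Gamma \<alpha> *
       (integral {0..a} (\<lambda>s. exp (lam * s) * (a - s) powr (\<alpha> - 1) * f (s, y s))
        - integral {0..t} (\<lambda>s. exp (lam * s) * (t - s) powr (\<alpha> - 1) * f (s, y s))))"

lemma domain_eq_graphs: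
  assumes "0 < a"
  shows "rhs_domain lam a ya \<gamma> = {(t, y t) | t y. t \<in> {0..a} \<and> y \<in> Omega lam a ya \<gamma>}"
proof (intro equalityI subsetI)
  fix p assume "p \<in> rhs_domain lam a ya \<gamma>"
  then obtain t u where p: "p = (t, u)" and t: "t \<in> {0..a}"
    and u: "\<bar>u - ya * exp (- lam * t)\<bar> \<le> \<gamma>"
    by (auto simp: rhs_domain_def abs_le_iff)
  define y where "y = (\<lambda>s\<in>{0..a}. ya * exp (- lam * s) + (u - ya * exp (- lam * t)))"
  have "continuous_on {0..a} (\<lambda>s. ya * exp (- lam * s) + (u - ya * exp (- lam * t)))"
    by (intro continuous_intros)
  then have "continuous_on {0..a} y"
    by (rule continuous_on_eq) (simp add: y_def)
  moreover have "max_norm {0..a} (\<lambda>s. y s - ya * exp (- lam * s)) \<le> \<gamma>"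
    unfolding max_norm_def using assms u by (intro cSUP_least) (auto simp: y_def)
  ultimately have "y \<in> Omega lam a ya \<gamma>"
    by (auto simp: Omega_def cont_fun_def y_def)
  moreover have "p = (t, y t)"
    using p t by (simp add: y_def)
  ultimately show "p \<in> {(t, y t) | t y. t \<in> {0..a} \<and> y \<in> Omega lam a ya \<gamma>}"
    using t by blast
next
  fix p assume "p \<in> {(t, y t) | t y. t \<in> {0..a} \<and> y \<in> Omega lam a ya \<gamma>}"
  then obtain t y where p: "p = (t, y t)" and t: "t \<in> {0..a}" and y: "y \<in> Omega lam a ya \<gamma>"
    by blast
  let ?d = "\<lambda>s. \<bar>y s - ya * exp (- lam * s)\<bar>"
  have "continuous_on {0..a} ?d"
    using y by (intro continuous_intros) (auto simp: Omega_def cont_fun_def)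
  then have "bdd_above (?d ` {0..a})"
    by (intro bounded_imp_bdd_above compact_imp_bounded compact_continuous_image) auto
  then have "?d t \<le> (SUP s\<in>{0..a}. ?d s)"
    using t by (rule cSUP_upper2) auto
  also have "\<dots> \<le> \<gamma>"
    using y by (simp add: Omega_def max_norm_def)
  finally show "p \<in> rhs_domain lam a ya \<gamma>"
    using p t by (auto simp: rhs_domain_def abs_le_iff)
qed

lemma domain_subset_rectangle_iff:
  assumes "0 < a" "0 \<le> \<gamma>"
  shows "rhs_domain lam a ya \<gamma> \<subseteq> {0..a} \<times> {ya * exp (- lam * a) - \<gamma> .. ya * exp (- lam * a) + \<gamma>}
    \<longleftrightarrow> lam = 0 \<or> ya = 0"
proof
  assume *: "rhs_domain lam a ya \<gamma> \<subseteq>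
    {0..a} \<times> {ya * exp (- lam * a) - \<gamma> .. ya * exp (- lam * a) + \<gamma>}"
  have "(0, ya + \<gamma>) \<in> rhs_domain lam a ya \<gamma>" "(0, ya - \<gamma>) \<in> rhs_domain lam a ya \<gamma>"
    using assms by (auto simp: rhs_domain_def)
  then have "ya = ya * exp (- lam * a)"
    using subsetD[OF *, of "(0, ya + \<gamma>)"] subsetD[OF *, of "(0, ya - \<gamma>)"] by auto
  then show "lam = 0 \<or> ya = 0"
    using assms by auto
qed (auto simp: rhs_domain_def)

lemma domain_eq_rectangle_iff:
  assumes "0 < a" "0 \<le> \<gamma>"
  shows "rhs_domain lam a ya \<gamma> = {0..a} \<times> {ya * exp (- lam * a) - \<gamma> .. ya * exp (- lam * a) + \<gamma>}
    \<longleftrightarrow> lam = 0 \<or> ya = 0"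
proof
  assume "rhs_domain lam a ya \<gamma> = {0..a} \<times> {ya * exp (- lam * a) - \<gamma> .. ya * exp (- lam * a) + \<gamma>}"
  then show "lam = 0 \<or> ya = 0"
    using domain_subset_rectangle_iff[OF assms] by blast
qed (auto simp: rhs_domain_def)

end

theory Submission
  imports Defs
begin

text \<open>Both integrals in the operator have an integrand of the form \<open>(b - s)\<^sup>\<alpha>\<^sup>-\<^sup>1 e\<^sup>\<lambda>\<^sup>s h(s)\<close> on
  \<open>[0,b]\<close> with \<open>b \<le> a\<close>, so each is at most \<open>e\<^sup>\<lambda>\<^sup>a a\<^sup>\<alpha> / \<alpha>\<close> times the maximum of \<open>\<bar>h\<bar>\<close>. For
  \<open>h(s) = f(s, y(s))\<close> the two bounds, divided by \<open>\<Gamma>(\<alpha>)\<close>, add up to \<open>\<gamma>\<close>, which gives invariance of \<open>\<Omega>\<^sub>\<gamma>\<close>; for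
  \<open>h(s) = f(s, y(s)) - f(s, z(s))\<close> they give the contraction constant
  \<open>q = 2 a\<^sup>\<alpha> e\<^sup>\<lambda>\<^sup>a L / \<Gamma>(\<alpha> + 1) < 1\<close>. The rest is Banach's fixed point theorem.\<close>

section \<open>Integration against the weakly singular power kernel\<close>

lemma powr_kernel_has_integral:
  fixes \<alpha> b :: real
  assumes "0 < \<alpha>" "0 \<le> b"
  shows "((\<lambda>s. (b - s) powr (\<alpha> - 1)) has_integral b powr \<alpha> / \<alpha>) {0..b}"
proof -
  have "((\<lambda>u. u powr (\<alpha> - 1)) has_integral b powr \<alpha> / \<alpha>) {0..b}"
    using has_integral_powr_from_0[of "\<alpha> - 1" b] assms by simp
  then have "((\<lambda>x. (- x) powr (\<alpha> - 1)) has_integral b powr \<alpha> / \<alpha>) {-b..-0}"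
    by (subst has_integral_reflect_real)
  from has_integral_shift_real_ivl[OF this, of "-b"] show ?thesis
    by simp
qed

text \<open>The change of variables \<open>u = b - s\<close>, carried out as a reflection followed
  by a translation. It moves the singularity from the upper limit \<open>b\<close> to the fixed
  point 0.\<close>

lemma powr_kernel_integral_substitution:
  fixes \<alpha> b :: real and k :: "real \<Rightarrow> real"
  shows "integral {0..b} (\<lambda>s. (b - s) powr (\<alpha> - 1) * k s)
    = integral {0..b} (\<lambda>u. u powr (\<alpha> - 1) * k (b - u))"
proof -
  let ?f = "\<lambda>u. u powr (\<alpha> - 1) * k (b - u)"
  have "integral {0..b} ?f = integral {-b..-0} (\<lambda>x. ?f (- x))"
    by (rule Henstock_Kurzweil_Integration.integral_reflect_real[symmetric])
  also have "\<dots> = integral {0..b} ((\<lambda>x. ?f (- x)) \<circ> (+) (- b))"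
    by (subst integral_shift_Icc_real) simp
  finally show ?thesis
    by (simp add: o_def)
qed

text \<open>Henstock-Kurzweil integrability alone does not survive multiplication by a continuous
  function. A nonnegative \<open>w\<close> is absolutely integrable, however, and \<open>k\<close>
  is bounded and measurable on the compact interval.\<close>

lemma integrable_mult_continuous:
  fixes w k :: "real \<Rightarrow> real"
  assumes "w integrable_on {c..d}" "\<And>s. s \<in> {c..d} \<Longrightarrow> 0 \<le> w s" "continuous_on {c..d} k"
  shows "(\<lambda>s. w s * k s) integrable_on {c..d}"
proof -
  have "(\<lambda>s. k s * w s) absolutely_integrable_on {c..d}"
    using assms
    by (intro absolutely_integrable_bounded_measurable_product_real
        continuous_imp_measurable_on_sets_lebesgue compact_imp_bounded compact_continuous_image
        nonnegative_absolutely_integrable_1) auto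
  then show ?thesis
    by (simp add: mult.commute set_lebesgue_integral_eq_integral(1))
qed

lemma powr_kernel_integrable:
  fixes \<alpha> b :: real
  assumes "0 < \<alpha>" "0 \<le> b" "continuous_on {0..b} k"
  shows "(\<lambda>s. (b - s) powr (\<alpha> - 1) * k s) integrable_on {0..b}"
  using assms powr_kernel_has_integral[of \<alpha> b]
  by (intro integrable_mult_continuous) (auto simp: integrable_on_def)

lemma weighted_integral_bound:
  fixes w k :: "real \<Rightarrow> real"
  assumes "w integrable_on {c..d}" "\<And>s. s \<in> {c..d} \<Longrightarrow> 0 \<le> w s" "continuous_on {c..d} k"
    and "\<And>s. s \<in> {c..d} \<Longrightarrow> \<bar>k s\<bar> \<le> B"
  shows "\<bar>integral {c..d} (\<lambda>s. w s * k s)\<bar> \<le> B * integral {c..d} w"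
proof -
  have "norm (integral {c..d} (\<lambda>s. w s * k s)) \<le> integral {c..d} (\<lambda>s. B * w s)"
  proof (rule integral_norm_bound_integral)
    show "(\<lambda>s. w s * k s) integrable_on {c..d}"
      using assms by (intro integrable_mult_continuous)
    show "(\<lambda>s. B * w s) integrable_on {c..d}"
      using assms(1) by (rule integrable_on_mult_right)
    show "norm (w s * k s) \<le> B * w s" if "s \<in> {c..d}" for s
      using mult_right_mono[OF assms(4) assms(2)] that assms(2)[OF that]
      by (simp add: abs_mult mult.commute)
  qed
  then show ?thesis
    by simp
qed

lemma powr_kernel_integral_bound:
  fixes \<alpha> b :: real
  assumes "0 < \<alpha>" "0 \<le> b" "continuous_on {0..b} k" "\<And>s. s \<in> {0..b} \<Longrightarrow> \<bar>k s\<bar> \<le> B"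
  shows "\<bar>integral {0..b} (\<lambda>s. (b - s) powr (\<alpha> - 1) * k s)\<bar> \<le> B * (b powr \<alpha> / \<alpha>)"
  using weighted_integral_bound[of "\<lambda>s. (b - s) powr (\<alpha> - 1)" 0 b k B] assms
    powr_kernel_has_integral[of \<alpha> b] by (auto simp: integrable_on_def integral_unique)

section \<open>Continuity of the singular integral in its upper limit\<close>

text \<open>For \<open>t\<close> and \<open>u\<close> in \<open>[0,a]\<close> the argument
  \<open>t - u\<close> stays in \<open>[-a,a]\<close>, where \<open>g\<close> is uniformly
  continuous. A change of \<open>g\<close> by at most \<open>\<epsilon>\<close> is then multiplied
  only by the total mass \<open>C\<close> of the weight, however singular \<open>w\<close>
  is.\<close>

lemma continuous_on_weighted_convolution:
  fixes w g :: "real \<Rightarrow> real"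
  assumes w: "w integrable_on {0..a}" "\<And>s. s \<in> {0..a} \<Longrightarrow> 0 \<le> w s"
    and g: "continuous_on UNIV g"
  shows "continuous_on {0..a} (\<lambda>t. integral {0..a} (\<lambda>u. w u * g (t - u)))"
proof (cases "0 \<le> a")
  case True
  define C where "C = integral {0..a} w"
  have C: "0 \<le> C"
    unfolding C_def using w by (rule integral_nonneg)
  have cont: "continuous_on {0..a} (\<lambda>u. g (t - u))" for t
    by (intro continuous_on_compose2[OF g] continuous_intros) auto
  have unif: "uniformly_continuous_on {-a..a} g"
    using g by (intro compact_uniformly_continuous) (auto intro: continuous_on_subset)
  show ?thesis
    unfolding continuous_on_iff
  proof (intro ballI allI impI)
    fix t e :: real
    assume t: "t \<in> {0..a}" and e: "0 < e"
    \<comment> \<open>Dividing by \<open>C + 1\<close> instead of \<open>C\<close> covers the case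
      \<open>C = 0\<close>.\<close>
    define \<epsilon> where "\<epsilon> = e / (C + 1)"
    have \<epsilon>: "0 < \<epsilon>" "\<epsilon> * C < e"
      using e C by (auto simp: \<epsilon>_def field_simps)
    obtain d where d: "0 < d"
      "\<And>x x'. x \<in> {-a..a} \<Longrightarrow> x' \<in> {-a..a} \<Longrightarrow> dist x' x < d \<Longrightarrow> dist (g x') (g x) < \<epsilon>"
      using unif \<epsilon>(1) unfolding uniformly_continuous_on_def by metis
    show "\<exists>d>0. \<forall>t'\<in>{0..a}. dist t' t < d \<longrightarrow>
      dist (integral {0..a} (\<lambda>u. w u * g (t' - u))) (integral {0..a} (\<lambda>u. w u * g (t - u))) < e"
    proof (intro exI[of _ d] conjI ballI impI d(1))
      fix t' assume t': "t' \<in> {0..a}" "dist t' t < d"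
      have "integral {0..a} (\<lambda>u. w u * g (t' - u)) - integral {0..a} (\<lambda>u. w u * g (t - u))
          = integral {0..a} (\<lambda>u. w u * (g (t' - u) - g (t - u)))"
        unfolding right_diff_distrib using w cont
        by (intro integral_diff[symmetric] integrable_mult_continuous)
      also have "\<bar>\<dots>\<bar> \<le> \<epsilon> * C"
        unfolding C_def
      proof (intro weighted_integral_bound w)
        show "\<bar>g (t' - u) - g (t - u)\<bar> \<le> \<epsilon>" if "u \<in> {0..a}" for u
          using d(2)[of "t - u" "t' - u"] that t t' by (auto simp: dist_real_def)
      qed (auto intro: continuous_on_diff cont)
      finally show "dist (integral {0..a} (\<lambda>u. w u * g (t' - u)))
          (integral {0..a} (\<lambda>u. w u * g (t - u))) < e"
        using \<epsilon> by (simp add: dist_real_def)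
    qed
  qed
qed auto

text \<open>After substituting \<open>u = t - s\<close> and extending \<open>k\<close> by the constant \<open>k 0\<close> to the left of
  \<open>0\<close>, the integral up to \<open>t\<close> becomes an integral over all of \<open>[0,a]\<close>, up to an explicit
  term; the singularity of the kernel then no longer moves with \<open>t\<close>.\<close>

lemma continuous_on_powr_kernel_integral:
  fixes \<alpha> a :: real
  assumes "0 < \<alpha>" "0 \<le> a" and k: "continuous_on {0..a} k"
  shows "continuous_on {0..a} (\<lambda>t. integral {0..t} (\<lambda>s. (t - s) powr (\<alpha> - 1) * k s))"
proof -
  define g where "g = ext_cont k 0 a"
  have g: "continuous_on UNIV g"
    unfolding g_def using k by (intro continuous_on_ext_cont) simp
  have g_eq: "g x = k x" if "x \<in> {0..a}" for x
    unfolding g_def using that by (intro ext_cont_cancel_cbox) simp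
  have g_neg: "g x = k 0" if "x \<le> 0" for x
    using that assms(2) by (cases "x = 0") (auto simp: g_def ext_cont_def clamp_def)
  define w where "w u = u powr (\<alpha> - 1)" for u :: real
  have w: "(w has_integral c powr \<alpha> / \<alpha>) {0..c}" if "0 \<le> c" for c
    unfolding w_def using has_integral_powr_from_0[of "\<alpha> - 1" c] assms that by simp
  have w_int: "w integrable_on {0..a}" and w_nonneg: "0 \<le> w u" for u
    using w[OF assms(2)] by (auto simp: integrable_on_def w_def)
  have split: "integral {0..t} (\<lambda>s. (t - s) powr (\<alpha> - 1) * k s)
    = integral {0..a} (\<lambda>u. w u * g (t - u)) - k 0 * (a powr \<alpha> / \<alpha> - t powr \<alpha> / \<alpha>)"
    if t: "t \<in> {0..a}" for t
  proof -
    have int: "(\<lambda>u. w u * g (t - u)) integrable_on {0..a}"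
      by (intro integrable_mult_continuous continuous_on_compose2[OF g] continuous_intros
          w_int w_nonneg) auto
    have "integral {0..t} w + integral {t..a} w = integral {0..a} w"
      using t by (intro Henstock_Kurzweil_Integration.integral_combine w_int) auto
    then have tail: "integral {t..a} w = a powr \<alpha> / \<alpha> - t powr \<alpha> / \<alpha>"
      using t w[of a] w[of t] by (auto simp: integral_unique)
    have "integral {0..t} (\<lambda>s. (t - s) powr (\<alpha> - 1) * k s)
        = integral {0..t} (\<lambda>u. w u * k (t - u))"
      unfolding w_def by (rule powr_kernel_integral_substitution)
    also have "\<dots> = integral {0..t} (\<lambda>u. w u * g (t - u))"
      using t by (intro integral_cong) (auto simp: g_eq)
    also have "\<dots> = integral {0..a} (\<lambda>u. w u * g (t - u)) - integral {t..a} (\<lambda>u. w u * g (t - u))"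
      using Henstock_Kurzweil_Integration.integral_combine[OF _ _ int, of t] t by simp
    \<comment> \<open>On \<open>[t,a]\<close> the argument \<open>t - u\<close> is at most 0, so the
      extension has the constant value \<open>k 0\<close> there and only the mass of
      \<open>w\<close> remains.\<close>
    also have "integral {t..a} (\<lambda>u. w u * g (t - u)) = integral {t..a} (\<lambda>u. w u * k 0)"
      by (intro integral_cong) (auto simp: g_neg)
    also have "\<dots> = k 0 * (a powr \<alpha> / \<alpha> - t powr \<alpha> / \<alpha>)"
      by (simp add: tail)
    finally show ?thesis .
  qed
  have "continuous_on {0..a} (\<lambda>t. integral {0..a} (\<lambda>u. w u * g (t - u)))"
    by (intro continuous_on_weighted_convolution g w_int w_nonneg)
  then have "continuous_on {0..a} (\<lambda>t. integral {0..a} (\<lambda>u. w u * g (t - u))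
      - k 0 * (a powr \<alpha> / \<alpha> - t powr \<alpha> / \<alpha>))"
    using assms by (intro continuous_intros continuous_on_powr') auto
  then show ?thesis
    by (rule continuous_on_eq) (simp add: split)
qed

section \<open>Maximum norm, function space and operator\<close>

lemma max_norm_upper:
  assumes "compact S" "continuous_on S g" "x \<in> S"
  shows "\<bar>g x\<bar> \<le> max_norm S g"
proof -
  have "bdd_above ((\<lambda>x. \<bar>g x\<bar>) ` S)"
    using assms by (intro bounded_imp_bdd_above compact_imp_bounded compact_continuous_image
        continuous_intros) auto
  then show ?thesis
    unfolding max_norm_def using assms(3) by (rule cSUP_upper[rotated])
qed

lemma max_norm_least:
  assumes "S \<noteq> {}" "\<And>x. x \<in> S \<Longrightarrow> \<bar>g x\<bar> \<le> B"
  shows "max_norm S g \<le> B"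
  unfolding max_norm_def using assms by (rule cSUP_least)

text \<open>Continuity on a compact interval makes the set under the supremum bounded above, so the
  supremum is a genuine pointwise bound; \<open>0 \<le> a\<close> makes that set nonempty.\<close>

lemma Omega_iff:
  assumes "0 \<le> a"
  shows "y \<in> Omega lam a ya \<gamma> \<longleftrightarrow> y \<in> extensional {0..a} \<and> continuous_on {0..a} y \<and>
    (\<forall>t\<in>{0..a}. \<bar>y t - ya * exp (- lam * t)\<bar> \<le> \<gamma>)"
proof -
  let ?d = "\<lambda>t. y t - ya * exp (- lam * t)"
  have "max_norm {0..a} ?d \<le> \<gamma> \<longleftrightarrow> (\<forall>t\<in>{0..a}. \<bar>?d t\<bar> \<le> \<gamma>)" if "continuous_on {0..a} y"
  proof -
    have "continuous_on {0..a} ?d"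
      using that by (intro continuous_intros)
    then have "\<bar>?d t\<bar> \<le> max_norm {0..a} ?d" if "t \<in> {0..a}" for t
      using that by (intro max_norm_upper[where g = ?d]) auto
    then show ?thesis
      using max_norm_least[of "{0..a}" ?d \<gamma>] assms by fastforce
  qed
  then show ?thesis
    by (auto simp: Omega_def cont_fun_def)
qed

text \<open>The domain is the image of a rectangle under a continuous shear. Compactness turns
  \<open>max_norm\<close> of \<open>f\<close> into an actual bound for the values of
  \<open>f\<close> along the graphs.\<close>

lemma compact_rhs_domain: "compact (rhs_domain lam a ya \<gamma>)"
proof -
  let ?F = "\<lambda>p. (fst p, ya * exp (- lam * fst p) + snd p) :: real \<times> real"
  have "rhs_domain lam a ya \<gamma> = ?F ` ({0..a} \<times> {-\<gamma>..\<gamma>})"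
  proof (intro equalityI subsetI)
    fix p assume "p \<in> rhs_domain lam a ya \<gamma>"
    then show "p \<in> ?F ` ({0..a} \<times> {-\<gamma>..\<gamma>})"
      by (intro image_eqI[of _ _ "(fst p, snd p - ya * exp (- lam * fst p))"])
        (auto simp: rhs_domain_def)
  qed (auto simp: rhs_domain_def)
  moreover have "compact (?F ` ({0..a} \<times> {-\<gamma>..\<gamma>}))"
    by (intro compact_continuous_image continuous_intros compact_Times) auto
  ultimately show ?thesis
    by simp
qed

text \<open>The integral part of the operator with its sign reversed, and with a general
  \<open>h\<close> in place of \<open>f (s, y s)\<close>. It is linear in \<open>h\<close>, so one
  estimate serves both invariance and contraction.\<close>

definition tempered_term :: "real \<Rightarrow> real \<Rightarrow> real \<Rightarrow> (real \<Rightarrow> real) \<Rightarrow> real \<Rightarrow> real" where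
  "tempered_term \<alpha> lam a h t = exp (- lam * t) / Gamma \<alpha> *
     (integral {0..a} (\<lambda>s. (a - s) powr (\<alpha> - 1) * (exp (lam * s) * h s))
      - integral {0..t} (\<lambda>s. (t - s) powr (\<alpha> - 1) * (exp (lam * s) * h s)))"

lemma op_A_eq:
  assumes "t \<in> {0..a}"
  shows "op_A \<alpha> lam a ya f y t = ya * exp (- lam * t) - tempered_term \<alpha> lam a (\<lambda>s. f (s, y s)) t"
proof -
  \<comment> \<open>The exponential splits into \<open>exp (- lam * t)\<close> and
    \<open>exp (lam * s)\<close>. The upper limit \<open>b\<close> is independent of
    \<open>t\<close> because both \<open>b = a\<close> and \<open>b = t\<close> occur.\<close>
  have "integral {0..b} (\<lambda>s. exp (- lam * (t - s)) * (b - s) powr (\<alpha> - 1) * f (s, y s))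
      = exp (- lam * t) * integral {0..b} (\<lambda>s. (b - s) powr (\<alpha> - 1) * (exp (lam * s) * f (s, y s)))"
    for b
    unfolding integral_mult_right[symmetric]
    by (intro integral_cong) (simp add: algebra_simps flip: exp_add)
  then show ?thesis
    unfolding op_A_def tempered_term_def using assms by (simp add: algebra_simps)
qed

text \<open>Both \<open>y\<close> and its image are \<open>undefined\<close> outside
  \<open>[0,a]\<close>, so the pointwise equation on the interval is equality of functions.\<close>

lemma solves_integral_equation_iff_fixed_point:
  assumes "y \<in> extensional {0..a}"
  shows "solves_integral_equation \<alpha> lam a ya f y \<longleftrightarrow> op_A \<alpha> lam a ya f y = y"
proof -
  have "op_A \<alpha> lam a ya f y = y \<longleftrightarrow> (\<forall>t\<in>{0..a}. op_A \<alpha> lam a ya f y t = y t)"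
  proof
    assume "\<forall>t\<in>{0..a}. op_A \<alpha> lam a ya f y t = y t"
    then show "op_A \<alpha> lam a ya f y = y"
      using assms by (intro extensionalityI[of _ "{0..a}"]) (auto simp: op_A_def)
  qed auto
  also have "\<dots> \<longleftrightarrow> solves_integral_equation \<alpha> lam a ya f y"
    unfolding solves_integral_equation_def
  proof (rule ball_cong[OF refl])
    fix t assume "t \<in> {0..a}"
    then show "op_A \<alpha> lam a ya f y t = y t \<longleftrightarrow> y t = ya * exp (- lam * t) - exp (- lam * t) / Gamma \<alpha> *
       (integral {0..a} (\<lambda>s. exp (lam * s) * (a - s) powr (\<alpha> - 1) * f (s, y s))
        - integral {0..t} (\<lambda>s. exp (lam * s) * (t - s) powr (\<alpha> - 1) * f (s, y s)))"
      by (subst op_A_eq) (auto simp: tempered_term_def mult.assoc mult.left_commute)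
  qed
  finally show ?thesis ..
qed

section \<open>Regularity, linearity and size of the tempered integral term\<close>

context
  fixes \<alpha> lam a :: real
  assumes \<alpha>: "0 < \<alpha>" and lam: "0 \<le> lam" and a: "0 < a"
begin

lemma continuous_on_tempered_term:
  assumes "continuous_on {0..a} h"
  shows "continuous_on {0..a} (tempered_term \<alpha> lam a h)"
  unfolding tempered_term_def using \<alpha> a assms less_imp_neq[OF Gamma_real_pos[OF \<alpha>]]
  by (intro continuous_intros continuous_on_powr_kernel_integral) auto

lemma tempered_term_diff:
  assumes h: "continuous_on {0..a} h" and k: "continuous_on {0..a} k" and t: "t \<in> {0..a}"
  shows "tempered_term \<alpha> lam a h t - tempered_term \<alpha> lam a k t
    = tempered_term \<alpha> lam a (\<lambda>s. h s - k s) t"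
proof -
  define I where
    "I g b = integral {0..b} (\<lambda>s. (b - s) powr (\<alpha> - 1) * (exp (lam * s) * g s))" for g b
  have "I (\<lambda>s. h s - k s) b = I h b - I k b" if "b \<in> {0..a}" for b
    unfolding I_def right_diff_distrib using that \<alpha>
    by (intro integral_diff powr_kernel_integrable continuous_intros continuous_on_subset[OF h]
        continuous_on_subset[OF k]) auto
  from this[of a] this[OF t] show ?thesis
    using a by (simp add: tempered_term_def flip: I_def)
      (simp add: algebra_simps add_divide_distrib diff_divide_distrib)
qed

text \<open>The factor 2 comes from estimating the two integrals separately. The outer exponential
  is at most 1, and \<open>\<alpha> * Gamma \<alpha> = Gamma (\<alpha> + 1)\<close> absorbs the
  \<open>1 / \<alpha>\<close> from integrating the kernel.\<close>

lemma tempered_term_bound: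
  assumes h: "continuous_on {0..a} h" and B: "\<And>s. s \<in> {0..a} \<Longrightarrow> \<bar>h s\<bar> \<le> B" and t: "t \<in> {0..a}"
  shows "\<bar>tempered_term \<alpha> lam a h t\<bar> \<le> 2 * a powr \<alpha> * exp (lam * a) / Gamma (\<alpha> + 1) * B"
proof -
  have G: "0 < Gamma \<alpha>" "Gamma (\<alpha> + 1) = \<alpha> * Gamma \<alpha>"
    using \<alpha> by (auto intro!: Gamma_real_pos Gamma_plus1 elim!: nonpos_Ints_cases')
  have B0: "0 \<le> B"
    using B[of 0] a by force
  define I where "I b = integral {0..b} (\<lambda>s. (b - s) powr (\<alpha> - 1) * (exp (lam * s) * h s))" for b
  have I: "\<bar>I b\<bar> \<le> exp (lam * a) * B * (a powr \<alpha> / \<alpha>)" if b: "b \<in> {0..a}" for b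
  proof -
    have "\<bar>I b\<bar> \<le> exp (lam * a) * B * (b powr \<alpha> / \<alpha>)"
      unfolding I_def
    proof (rule powr_kernel_integral_bound)
      show "continuous_on {0..b} (\<lambda>s. exp (lam * s) * h s)"
        using b by (intro continuous_intros continuous_on_subset[OF h]) auto
      show "\<bar>exp (lam * s) * h s\<bar> \<le> exp (lam * a) * B" if "s \<in> {0..b}" for s
        using that b B[of s] lam B0 by (auto simp: abs_mult intro!: mult_mono mult_left_mono)
    qed (use \<alpha> b in auto)
    also have "\<dots> \<le> exp (lam * a) * B * (a powr \<alpha> / \<alpha>)"
      using b \<alpha> B0 by (intro mult_left_mono divide_right_mono powr_mono2) auto
    finally show ?thesis .
  qed
  have "\<bar>tempered_term \<alpha> lam a h t\<bar> = exp (- lam * t) * (\<bar>I a - I t\<bar> / Gamma \<alpha>)"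
    using G(1) by (simp add: tempered_term_def I_def abs_mult)
  also have "\<dots> \<le> 1 * (2 * (exp (lam * a) * B * (a powr \<alpha> / \<alpha>)) / Gamma \<alpha>)"
  proof (intro mult_mono divide_right_mono)
    show "\<bar>I a - I t\<bar> \<le> 2 * (exp (lam * a) * B * (a powr \<alpha> / \<alpha>))"
      using I[of a] I[OF t] a by simp
  qed (use lam t G(1) in auto)
  also have "\<dots> = 2 * a powr \<alpha> * exp (lam * a) / Gamma (\<alpha> + 1) * B"
    using G \<alpha> by (simp add: field_simps)
  finally show ?thesis .
qed

end

section \<open>The fixed point theorem on \<open>Omega\<close>\<close>

text \<open>The contraction principle of the library needs a complete metric type, so \<open>Omega\<close> is
  transferred to a closed set \<open>S\<close> of bounded continuous functions on the whole line: \<open>R\<close> restricts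
  these to \<open>[0,a]\<close>, and \<open>E\<close> extends a function on \<open>[0,a]\<close> by its boundary values.\<close>

lemma fixed_point_Omega:
  assumes a: "0 \<le> a" and \<gamma>: "0 \<le> \<gamma>" and q: "0 \<le> q" "q < 1"
    and maps: "T \<in> Omega lam a ya \<gamma> \<rightarrow> Omega lam a ya \<gamma>"
    and contr: "\<And>y z. y \<in> Omega lam a ya \<gamma> \<Longrightarrow> z \<in> Omega lam a ya \<gamma> \<Longrightarrow>
      max_norm {0..a} (\<lambda>t. T y t - T z t) \<le> q * max_norm {0..a} (\<lambda>t. y t - z t)"
  obtains y where "y \<in> Omega lam a ya \<gamma>" "T y = y"
    "\<And>z. z \<in> Omega lam a ya \<gamma> \<Longrightarrow> T z = z \<Longrightarrow> z = y"
proof -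
  let ?\<Omega> = "Omega lam a ya \<gamma>"
  \<comment> \<open>Members of \<open>S\<close> are constrained on \<open>[0,a]\<close> only, which
    makes \<open>g \<in> S\<close> equivalent to
    \<open>R g \<in> Omega lam a ya \<gamma>\<close>.\<close>
  define S :: "(real \<Rightarrow>\<^sub>C real) set" where
    "S = PiC {0..a} (\<lambda>t. cball (ya * exp (- lam * t)) \<gamma>)"
  define R where "R g = restrict (apply_bcontfun g) {0..a}" for g :: "real \<Rightarrow>\<^sub>C real"
  have cont: "continuous_on {0..a} y" if "y \<in> ?\<Omega>" for y
    using that a by (simp add: Omega_iff)
  have diff_le: "\<bar>y t - z t\<bar> \<le> max_norm {0..a} (\<lambda>t. y t - z t)"
    if "y \<in> ?\<Omega>" "z \<in> ?\<Omega>" "t \<in> {0..a}" for y z t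
    using that by (intro max_norm_upper[where g = "\<lambda>t. y t - z t"] continuous_intros cont) auto
  have R: "R g \<in> ?\<Omega> \<longleftrightarrow> g \<in> S" for g
  proof -
    have "continuous_on {0..a} (R g)"
      by (rule continuous_on_eq[of _ "apply_bcontfun g"]) (auto simp: R_def)
    then show ?thesis
      by (auto simp: Omega_iff[OF a] S_def mem_PiC_iff Pi_iff R_def dist_real_def abs_minus_commute)
  qed
  have "\<exists>g. R g = y \<and> (\<forall>x. apply_bcontfun g x = y (clamp 0 a x))" if y: "y \<in> ?\<Omega>" for y
  proof -
    have "continuous_on (cbox 0 a) y"
      using cont[OF y] by simp
    from continuous_on_cbox_bcontfunE[OF this] obtain g :: "real \<Rightarrow>\<^sub>C real" where
      g: "\<And>x. x \<in> cbox 0 a \<Longrightarrow> apply_bcontfun g x = y x" "\<And>x. apply_bcontfun g x = y (clamp 0 a x)"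
      by blast
    have "R g = y"
      using y a g(1) by (intro extensionalityI[of _ "{0..a}"]) (auto simp: R_def Omega_iff)
    with g(2) show ?thesis
      by blast
  qed
  then obtain E where E: "\<And>y. y \<in> ?\<Omega> \<Longrightarrow> R (E y) = y"
    "\<And>y x. y \<in> ?\<Omega> \<Longrightarrow> apply_bcontfun (E y) x = y (clamp 0 a x)"
    by metis
  have clamp: "clamp 0 a x \<in> {0..a}" for x
    using clamp_in_interval[of 0 a x] a by simp
  \<comment> \<open>\<open>R\<close> does not increase distances, and every value of
    \<open>E y\<close> on the line is a value of \<open>y\<close> on \<open>[0,a]\<close>; hence the
    factor \<open>q\<close> carries over to the transferred map. Since \<open>R (E y) = y\<close> on
    \<open>Omega\<close>, applying \<open>R\<close> to a fixed point gives a fixed point of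
    \<open>T\<close>.\<close>
  have "\<exists>!g\<in>S. E (T (R g)) = g"
  proof (rule Banach_fix[OF _ _ q])
    show "complete S"
      unfolding S_def complete_eq_closed by (intro closed_PiC closed_cball)
    \<comment> \<open>The centre of \<open>Omega\<close> witnesses nonemptiness, as
      \<open>0 \<le> \<gamma>\<close>.\<close>
    have "continuous_on {0..a} (\<lambda>t\<in>{0..a}. ya * exp (- lam * t))"
      by (rule continuous_on_eq[of _ "\<lambda>t. ya * exp (- lam * t)"]) (auto intro!: continuous_intros)
    then have "(\<lambda>t\<in>{0..a}. ya * exp (- lam * t)) \<in> ?\<Omega>"
      using \<gamma> by (simp add: Omega_iff[OF a])
    from E(1)[OF this] this R show "S \<noteq> {}"
      by (metis empty_iff)
    show "(\<lambda>g. E (T (R g))) ` S \<subseteq> S"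
      using maps E(1) R by (auto simp: Pi_iff) (metis)
  next
    fix g h assume gh: "g \<in> S" "h \<in> S"
    then have \<Omega>: "R g \<in> ?\<Omega>" "R h \<in> ?\<Omega>" "T (R g) \<in> ?\<Omega>" "T (R h) \<in> ?\<Omega>"
      using maps R by auto
    have "max_norm {0..a} (\<lambda>t. R g t - R h t) \<le> dist g h"
      using a dist_bounded[of g _ h] by (intro max_norm_least) (auto simp: R_def dist_real_def)
    then have "q * max_norm {0..a} (\<lambda>t. R g t - R h t) \<le> q * dist g h"
      using q(1) by (rule mult_left_mono)
    moreover have "\<bar>T (R g) (clamp 0 a x) - T (R h) (clamp 0 a x)\<bar>
        \<le> q * max_norm {0..a} (\<lambda>t. R g t - R h t)" for x
      using diff_le[OF \<Omega>(3,4) clamp] contr[OF \<Omega>(1,2)] by (rule order_trans)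
    ultimately show "dist (E (T (R g))) (E (T (R h))) \<le> q * dist g h"
      by (intro dist_bound) (metis E(2) \<Omega>(3,4) dist_real_def order_trans)
  qed
  then obtain g where g: "g \<in> S" "E (T (R g)) = g"
    by blast
  have y: "R g \<in> ?\<Omega>"
    using g(1) R by simp
  then have fixed: "T (R g) = R g"
    using E(1)[OF funcset_mem[OF maps y]] g(2) by simp
  show thesis
  proof (rule that[OF y fixed])
    fix z assume z: "z \<in> ?\<Omega>" "T z = z"
    \<comment> \<open>Uniqueness is taken directly from the contraction estimate: the distance
      \<open>m\<close> of two fixed points satisfies \<open>m \<le> q * m\<close> with
      \<open>q < 1\<close>.\<close>
    define m where "m = max_norm {0..a} (\<lambda>t. z t - R g t)"
    have "m \<le> q * m"
      using contr[OF z(1) y] z(2) fixed by (simp add: m_def)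
    then have "m \<le> 0"
      using q by (smt (verit) mult_le_cancel_right1)
    then have "z t = R g t" if "t \<in> {0..a}" for t
      using diff_le[OF z(1) y that] by (simp add: m_def)
    then show "z = R g"
      using z(1) y a by (intro extensionalityI[of _ "{0..a}"]) (auto simp: Omega_iff)
  qed
qed

section \<open>Invariance, contraction and the unique solution\<close>

theorem theorem3:
  fixes \<alpha> lam a ya \<gamma> L :: real and f :: "real \<times> real \<Rightarrow> real"
  assumes "0 < \<alpha>" "\<alpha> < 1" "0 \<le> lam" "0 < a"
    and "0 \<le> \<gamma>"
    and "\<gamma> = 2 * a powr \<alpha> * max_norm (rhs_domain lam a ya \<gamma>) f * exp (lam * a) / Gamma (1 + \<alpha>)"
    and "continuous_on (rhs_domain lam a ya \<gamma>) f"
    and "L > 0"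
    and "\<And>t y z. t \<in> {0..a} \<Longrightarrow> y \<in> Omega lam a ya \<gamma> \<Longrightarrow> z \<in> Omega lam a ya \<gamma> \<Longrightarrow>
           \<bar>f (t, y t) - f (t, z t)\<bar> \<le> L * \<bar>y t - z t\<bar>"
    and "L < Gamma (\<alpha> + 1) / (2 * a powr \<alpha> * exp (lam * a))"
  shows "op_A \<alpha> lam a ya f \<in> Omega lam a ya \<gamma> \<rightarrow> Omega lam a ya \<gamma> \<and>
    (\<exists>q\<in>{0..<1}. \<forall>y\<in>Omega lam a ya \<gamma>. \<forall>z\<in>Omega lam a ya \<gamma>.
       max_norm {0..a} (\<lambda>t. op_A \<alpha> lam a ya f y t - op_A \<alpha> lam a ya f z t)
         \<le> q * max_norm {0..a} (\<lambda>t. y t - z t)) \<and>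
    (\<exists>ystar\<in>Omega lam a ya \<gamma>.
       (\<forall>y\<in>Omega lam a ya \<gamma>. solves_integral_equation \<alpha> lam a ya f y \<longleftrightarrow> y = ystar) \<and>
       (\<forall>y\<in>Omega lam a ya \<gamma>. op_A \<alpha> lam a ya f y = y \<longleftrightarrow> y = ystar))"
proof -
  let ?\<Omega> = "Omega lam a ya \<gamma>" and ?D = "rhs_domain lam a ya \<gamma>" and ?A = "op_A \<alpha> lam a ya f"
  define C where "C = 2 * a powr \<alpha> * exp (lam * a) / Gamma (\<alpha> + 1)"
  define F where "F y = tempered_term \<alpha> lam a (\<lambda>s. f (s, y s))" for y
  have a: "0 \<le> a" and G: "0 < Gamma (\<alpha> + 1)"
    using assms by (auto intro: Gamma_real_pos)
  note tempered = assms(1,3,4)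
  have \<Omega>: "y \<in> extensional {0..a}" "continuous_on {0..a} y" if "y \<in> ?\<Omega>" for y
    using that a by (auto simp: Omega_iff)
  have graph: "(t, y t) \<in> ?D" if "y \<in> ?\<Omega>" "t \<in> {0..a}" for y t
    using that domain_eq_graphs[OF assms(4)] by blast
  have cont_f: "continuous_on {0..a} (\<lambda>s. f (s, y s))" if "y \<in> ?\<Omega>" for y
    using that by (intro continuous_on_compose2[OF assms(7)] continuous_intros \<Omega>) (auto simp: graph)
  have A_eq: "?A y t = ya * exp (- lam * t) - F y t" if "t \<in> {0..a}" for y t
    unfolding F_def using that by (rule op_A_eq)
  have maps: "?A \<in> ?\<Omega> \<rightarrow> ?\<Omega>"
  proof
    fix y assume y: "y \<in> ?\<Omega>"
    have "continuous_on {0..a} (\<lambda>t. ya * exp (- lam * t) - F y t)"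
      unfolding F_def
      by (intro continuous_intros continuous_on_tempered_term tempered cont_f y)
    then have "continuous_on {0..a} (?A y)"
      by (rule continuous_on_eq) (simp add: A_eq)
    moreover have "\<bar>?A y t - ya * exp (- lam * t)\<bar> \<le> \<gamma>" if t: "t \<in> {0..a}" for t
    proof -
      have "\<bar>F y t\<bar> \<le> C * max_norm ?D f"
        unfolding F_def C_def
        by (intro tempered_term_bound tempered cont_f y t max_norm_upper compact_rhs_domain
            assms(7) graph)
      \<comment> \<open>This is the implicit equation for \<open>\<gamma>\<close>. As
        \<open>\<gamma>\<close> also occurs on its right-hand side, through the domain, it is
        unfolded by \<open>subst\<close> before simplifying.\<close>
      also have "\<dots> = \<gamma>"
        by (subst assms(6)) (simp add: C_def add.commute)
      finally show ?thesis
        by (simp add: A_eq[OF t])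
    qed
    ultimately show "?A y \<in> ?\<Omega>"
      by (simp add: Omega_iff[OF a] op_A_def)
  qed
  \<comment> \<open>\<open>C\<close> is the reciprocal of the bound assumed for \<open>L\<close>, so
    that assumption says exactly \<open>q < 1\<close>.\<close>
  define q where "q = C * L"
  have q: "0 \<le> q" "q < 1"
    using assms(4,8,10) G by (auto simp: q_def C_def field_simps)
  have contr: "max_norm {0..a} (\<lambda>t. ?A y t - ?A z t) \<le> q * max_norm {0..a} (\<lambda>t. y t - z t)"
    if y: "y \<in> ?\<Omega>" and z: "z \<in> ?\<Omega>" for y z
  proof (rule max_norm_least)
    fix t assume t: "t \<in> {0..a}"
    \<comment> \<open>The centre cancels, and the order of \<open>y\<close> and \<open>z\<close> is
      reversed because \<open>F\<close> enters the operator with a minus sign.\<close>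
    have "?A y t - ?A z t = F z t - F y t"
      using t by (simp add: A_eq)
    also have "\<dots> = tempered_term \<alpha> lam a (\<lambda>s. f (s, z s) - f (s, y s)) t"
      unfolding F_def by (intro tempered_term_diff tempered cont_f y z t)
    also have "\<bar>\<dots>\<bar> \<le> C * (L * max_norm {0..a} (\<lambda>t. y t - z t))"
      unfolding C_def
    proof (intro tempered_term_bound tempered t continuous_intros cont_f y z)
      fix s assume s: "s \<in> {0..a}"
      have "\<bar>y s - z s\<bar> \<le> max_norm {0..a} (\<lambda>t. y t - z t)"
        using s y z by (intro max_norm_upper[where g = "\<lambda>t. y t - z t"] continuous_intros \<Omega>) auto
      then have "L * \<bar>y s - z s\<bar> \<le> L * max_norm {0..a} (\<lambda>t. y t - z t)"
        using assms(8) by (intro mult_left_mono) auto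
      with assms(9)[OF s y z]
      show "\<bar>f (s, z s) - f (s, y s)\<bar> \<le> L * max_norm {0..a} (\<lambda>t. y t - z t)"
        by (simp add: abs_minus_commute)
    qed
    finally show "\<bar>?A y t - ?A z t\<bar> \<le> q * max_norm {0..a} (\<lambda>t. y t - z t)"
      by (simp add: q_def mult.assoc)
  qed (use a in auto)
  obtain ystar where ystar: "ystar \<in> ?\<Omega>" "?A ystar = ystar"
    "\<And>z. z \<in> ?\<Omega> \<Longrightarrow> ?A z = z \<Longrightarrow> z = ystar"
    using fixed_point_Omega[OF a assms(5) q maps contr] by metis
  then have fp: "\<forall>y\<in>?\<Omega>. ?A y = y \<longleftrightarrow> y = ystar"
    by blast
  then have "\<forall>y\<in>?\<Omega>. solves_integral_equation \<alpha> lam a ya f y \<longleftrightarrow> y = ystar"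
    using solves_integral_equation_iff_fixed_point[OF \<Omega>(1)] by blast
  with maps q contr ystar(1) fp show ?thesis
    by (intro conjI bexI[of _ q] bexI[of _ ystar]) auto
qed

end
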